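(* Let $a\in\mathbb{C}$ and let $p\in\mathbb{C}[x]$ be of degree $n$ such that for all $\alpha\in[0,n)$ the Riemann-Liouville fractional derivative $D_a^{\alpha}p$ has no double zeros. Let $z_1,z_2,\dots,z_n$ be the zeros of $p$, and for $1\le j\le n$ let $z_j:[0,n)\to\mathbb{C}$ be the implicit functions given by $D_a^{\alpha}p(z_j(\alpha))=0$ with $z_j(0)=z_j$. Then there is an ordering of the roots $z_1,z_2,\dots,z_n$ such that $\lim_{\alpha\to j}z_j(\alpha)=a$.
   Context: For a polynomial $p(x)=\sum_{j=0}^n c_j(x-a)^j\in\mathbb{C}[x]$ and real $\alpha$, the Riemann-Liouville fractional derivative $D_a^{\alpha}p$ with base point $a$ is obtained by linearity from the power rule: $D_a^{\alpha}(x-a)^j=0$ if $\alpha-j$ is a positive integer, and $D_a^{\alpha}(x-a)^j=\frac{\Gamma(j+1)}{\Gamma(j-\alpha+1)}(x-a)^{j-\alpha}$ otherwise, where $\Gamma$ is the gamma function and powers are computed with the principal branch of the complex logarithm. The implicit functions $z_j(\alpha)$ are the paths of zeros of $D_a^{\alpha}p$ as $\alpha$ varies over $[0,n)$, the $j$-th one starting at the zero $z_j$ of $p$ at $\alpha=0$. *)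

theory Defs
  imports
    "HOL-Analysis.Analysis"
    "HOL-Computational_Algebra.Polynomial"
    "HOL-Combinatorics.Permutations"
begin

text \<open>
  Powers with real exponent on the principal branch. \<open>powr\<close> satisfies \<open>0 powr 0 = 0\<close>; the
  value must be \<open>1\<close> here, since for \<open>\<alpha> = j\<close> the power rule turns \<open>(x - a)\<^sup>j\<close> into a
  constant.
\<close>
definition cpow :: "complex \<Rightarrow> real \<Rightarrow> complex" where
  "cpow w \<beta> = (if \<beta> = 0 then 1 else w powr complex_of_real \<beta>)"

definition rl_deriv_power :: "complex \<Rightarrow> real \<Rightarrow> nat \<Rightarrow> complex \<Rightarrow> complex" where
  "rl_deriv_power a \<alpha> j x =
     (if \<exists>m::nat. 0 < m \<and> \<alpha> - real j = real m then 0
      else complex_of_real (Gamma (real j + 1) / Gamma (real j - \<alpha> + 1)) *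
           cpow (x - a) (real j - \<alpha>))"

text \<open>
  The coefficient of \<open>(x - a)\<^sup>j\<close> in the expansion of \<open>p\<close> about \<open>a\<close> is the \<open>j\<close>-th
  coefficient of \<open>p(a + x)\<close>.
\<close>
definition rl_deriv :: "complex \<Rightarrow> real \<Rightarrow> complex poly \<Rightarrow> complex \<Rightarrow> complex" where
  "rl_deriv a \<alpha> p x =
     (\<Sum>j\<le>degree p. coeff (pcompose p [:a, 1:]) j * rl_deriv_power a \<alpha> j x)"

text \<open>
  A zero of multiplicity at least two. This is also meaningful at points \<open>w \<noteq> a\<close> of the branch
  cut of \<open>rl_deriv a \<alpha> p\<close>: near \<open>w\<close> that function is a polynomial times the discontinuous
  factor \<open>(x - a) powr -\<alpha>\<close>, whose modulus is bounded and bounded away from \<open>0\<close>, so at a zero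
  the difference quotient tends to \<open>0\<close> iff the polynomial factor has a multiple zero at \<open>w\<close>.
\<close>
definition double_zero :: "(complex \<Rightarrow> complex) \<Rightarrow> complex \<Rightarrow> bool" where
  "double_zero f w \<longleftrightarrow> f w = 0 \<and> (f has_field_derivative 0) (at w)"

text \<open>
  The paths \<open>z 1, \<dots>, z n\<close> of zeros on \<open>[0, n)\<close> starting at \<open>r 1, \<dots>, r n\<close>.

  The base point \<open>a\<close>, where \<open>rl_deriv a \<alpha> p\<close> is in general singular, needs care. At an integer
  \<open>\<alpha> = k\<close> the derivative has only \<open>n - k\<close> zeros, so paths run into \<open>a\<close> there, although the
  \<open>k\<close>-th derivative of \<open>p\<close> need not vanish at \<open>a\<close>. Hence the zero equation is required away
  from \<open>a\<close> only. Several paths may meet at \<open>a\<close>, and the continuation of a path beyond such a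
  point is not unique; the last condition says that different indices follow different zeros
  for all non-integral \<open>\<alpha>\<close>.
\<close>
definition zero_paths ::
  "complex \<Rightarrow> complex poly \<Rightarrow> nat \<Rightarrow> (nat \<Rightarrow> complex) \<Rightarrow> (nat \<Rightarrow> real \<Rightarrow> complex) \<Rightarrow> bool" where
  "zero_paths a p n r z \<longleftrightarrow>
     (\<forall>j\<in>{1..n}. continuous_on {0..<real n} (z j)) \<and>
     (\<forall>j\<in>{1..n}. z j 0 = r j) \<and>
     (\<forall>j\<in>{1..n}. \<forall>\<alpha>\<in>{0..<real n}. z j \<alpha> \<noteq> a \<longrightarrow> rl_deriv a \<alpha> p (z j \<alpha>) = 0) \<and>
     (\<forall>\<alpha>\<in>{0..<real n} - \<int>. \<forall>i\<in>{1..n}. \<forall>j\<in>{1..n}.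
        i \<noteq> j \<longrightarrow> z i \<alpha> \<noteq> a \<longrightarrow> z i \<alpha> \<noteq> z j \<alpha>)"

end

(* Off the base point, D^alpha p (a + w) = w powr (-alpha) * P_alpha(w), where P_alpha is a
   polynomial in w whose coefficients are continuous (indeed entire) in alpha, because 1/Gamma is.
   For an integer k < n, w^k divides P_k, so P_k has at most n - k nonzero roots. Two paths cannot
   meet at such a root when alpha = k: for alpha near k they would be distinct roots of P_alpha,
   so the divided difference of P_alpha at them vanishes, and in the limit P_k would have a
   multiple root, i.e. a double zero of the derivative. So at least k paths are at a when
   alpha = k. As alpha tends to n, P_alpha tends to a multiple of w^n and all paths tend to a.
   The ordering is then chosen greedily: at stage k at most k - 1 of the at least k eligible paths
   have been used. *)

theory Submission imports Defs begin

section \<open>Greedy choice of distinct representatives\<close>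

lemma greedy_permutation:
  fixes S :: "nat \<Rightarrow> nat set"
  assumes sub: "\<And>k. k \<in> {1..n} \<Longrightarrow> S k \<subseteq> {1..n}"
    and card: "\<And>k. k \<in> {1..n} \<Longrightarrow> k \<le> card (S k)"
  shows "\<exists>\<sigma>. \<sigma> permutes {1..n} \<and> (\<forall>k\<in>{1..n}. \<sigma> k \<in> S k)"
proof -
  have "m \<le> n \<Longrightarrow> \<exists>f. inj_on f {1..m} \<and> (\<forall>k\<in>{1..m}. f k \<in> S k)" for m
  proof (induction m)
    case 0
    show ?case by simp
  next
    case (Suc m)
    then obtain f where f: "inj_on f {1..m}" "\<forall>k\<in>{1..m}. f k \<in> S k" by auto
    have "card (f ` {1..m}) \<le> m" using card_image_le[of "{1..m}" f] by simp
    also have "m < card (S (Suc m))" using card[of "Suc m"] Suc.prems by simp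
    finally have "\<not> S (Suc m) \<subseteq> f ` {1..m}"
      using card_mono[of "f ` {1..m}" "S (Suc m)"] by auto
    then obtain y where y: "y \<in> S (Suc m)" "y \<notin> f ` {1..m}" by blast
    have eq: "{1..Suc m} = insert (Suc m) {1..m}" by auto
    have "inj_on (f(Suc m := y)) {1..m}"
      using f(1) y(2) by (rule inj_on_fun_updI)
    moreover have "(f(Suc m := y)) ` {1..m} = f ` {1..m}" by (rule image_cong) auto
    ultimately have "inj_on (f(Suc m := y)) {1..Suc m}"
      unfolding eq inj_on_insert using y(2) by simp
    moreover have "\<forall>k\<in>{1..Suc m}. (f(Suc m := y)) k \<in> S k"
      unfolding eq using f(2) y(1) by auto
    ultimately show ?case by blast
  qed
  from this[of n] obtain f where f: "inj_on f {1..n}" "\<forall>k\<in>{1..n}. f k \<in> S k" by auto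
  \<comment> \<open>Outside {1..n} the choice is extended by the identity, as
    \<open>permutes\<close> demands.\<close>
  define \<sigma> where "\<sigma> = (\<lambda>k. if k \<in> {1..n} then f k else k)"
  have "inj_on \<sigma> {1..n}" using f(1) by (subst inj_on_cong[of _ _ f]) (simp_all add: \<sigma>_def)
  moreover have "\<sigma> ` {1..n} \<subseteq> {1..n}"
  proof (rule image_subsetI)
    fix k
    assume k: "k \<in> {1..n}"
    then have "f k \<in> {1..n}" using f(2) sub[OF k] by blast
    with k show "\<sigma> k \<in> {1..n}" by (simp add: \<sigma>_def)
  qed
  ultimately have "bij_betw \<sigma> {1..n} {1..n}"
    by (simp add: bij_betw_def endo_inj_surj)
  then have "\<sigma> permutes {1..n}" by (rule bij_imp_permutes) (auto simp: \<sigma>_def)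
  moreover have "\<forall>k\<in>{1..n}. \<sigma> k \<in> S k" using f(2) by (simp add: \<sigma>_def)
  ultimately show ?thesis by blast
qed

section \<open>The polynomial factor of the fractional derivative\<close>

definition frac_coeff :: "complex \<Rightarrow> complex poly \<Rightarrow> nat \<Rightarrow> real \<Rightarrow> complex" where
  "frac_coeff a p j \<alpha> =
     coeff (pcompose p [:a, 1:]) j * complex_of_real (Gamma (real j + 1) * rGamma (real j - \<alpha> + 1))"

definition frac_poly :: "complex \<Rightarrow> complex poly \<Rightarrow> real \<Rightarrow> complex poly" where
  "frac_poly a p \<alpha> = (\<Sum>j\<le>degree p. monom (frac_coeff a p j \<alpha>) j)"

lemma poly_frac_poly: "poly (frac_poly a p \<alpha>) w = (\<Sum>j\<le>degree p. frac_coeff a p j \<alpha> * w ^ j)"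
  by (simp add: frac_poly_def poly_sum poly_monom)

lemma coeff_frac_poly:
  "coeff (frac_poly a p \<alpha>) j = (if j \<le> degree p then frac_coeff a p j \<alpha> else 0)"
  by (simp add: frac_poly_def coeff_sum)

lemma poly_pderiv_frac_poly:
  "poly (pderiv (frac_poly a p \<alpha>)) w =
     (\<Sum>j\<le>degree p. frac_coeff a p j \<alpha> * (of_nat j * w ^ (j - 1)))"
proof -
  have "pderiv (\<Sum>j\<le>degree p. monom (frac_coeff a p j \<alpha>) j) =
      (\<Sum>j\<le>degree p. pderiv (monom (frac_coeff a p j \<alpha>) j))"
    using higher_pderiv_sum[where n = 1] by simp
  then show ?thesis
    by (simp add: frac_poly_def pderiv_monom poly_sum poly_monom mult_ac)
qed

text \<open>This is the reason for writing the power rule with \<open>rGamma\<close>: the reciprocal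
  gamma function is entire, so no order has to be excluded.\<close>

lemma continuous_frac_coeff: "isCont (frac_coeff a p j) \<alpha>"
  unfolding frac_coeff_def by (intro continuous_intros)

text \<open>The zeros of \<open>rGamma\<close> at the nonpositive integers reproduce the exceptional
  case of the power rule.\<close>

lemma frac_coeff_eq_0:
  assumes "j < k"
  shows "frac_coeff a p j (real k) = 0"
proof -
  have "real j - real k + 1 = - of_nat (k - j - 1)" using assms by (simp add: of_nat_diff)
  then have "rGamma (real j - real k + 1) = 0" by (simp only: rGamma_neg_of_nat)
  then show ?thesis by (simp add: frac_coeff_def)
qed

text \<open>Translation by a keeps the leading coefficient, and both gamma arguments are positive.
  The range of \<alpha> includes n itself, where the limit of all paths is taken.\<close>

lemma lead_frac_coeff_nonzero:
  assumes "p \<noteq> 0" "\<alpha> < real (degree p) + 1"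
  shows "frac_coeff a p (degree p) \<alpha> \<noteq> 0"
proof -
  have "coeff (pcompose p [:a, 1:]) (degree p) = lead_coeff p"
    using lead_coeff_comp[of "[:a, 1:]" p] by (simp add: degree_pcompose)
  moreover have "Gamma (real (degree p) + 1) > 0" "Gamma (real (degree p) - \<alpha> + 1) > 0"
    using assms by (auto intro!: Gamma_real_pos)
  ultimately show ?thesis
    using assms unfolding frac_coeff_def rGamma_inverse_Gamma by (simp add: less_imp_neq[symmetric])
qed

lemma rl_deriv_eq_frac_poly:
  assumes "x \<noteq> a"
  shows "rl_deriv a \<alpha> p x = (x - a) powr (- complex_of_real \<alpha>) * poly (frac_poly a p \<alpha>) (x - a)"
proof -
  have "coeff (pcompose p [:a, 1:]) j * rl_deriv_power a \<alpha> j x =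
      (x - a) powr (- complex_of_real \<alpha>) * (frac_coeff a p j \<alpha> * (x - a) ^ j)" for j
  proof (cases "\<exists>m::nat. 0 < m \<and> \<alpha> - real j = real m")
    case True
    then obtain m where "0 < m" "\<alpha> - real j = real m" by blast
    then have "frac_coeff a p j \<alpha> = 0"
      using frac_coeff_eq_0[of j "j + m" a p] by (simp add: algebra_simps)
    with True show ?thesis by (simp add: rl_deriv_power_def)
  next
    case False
    \<comment> \<open>For exponent 0 both sides are 1, because the base is nonzero.\<close>
    have "cpow (x - a) (real j - \<alpha>) = (x - a) powr (of_nat j + - complex_of_real \<alpha>)"
      using assms by (auto simp: cpow_def)
    also have "\<dots> = (x - a) ^ j * (x - a) powr (- complex_of_real \<alpha>)"
      using assms by (subst powr_add) (simp add: powr_nat')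
    finally show ?thesis unfolding rl_deriv_power_def if_not_P[OF False]
      by (simp add: frac_coeff_def rGamma_inverse_Gamma divide_inverse)
  qed
  then show ?thesis
    by (simp add: rl_deriv_def poly_frac_poly sum_distrib_left)
qed

lemma rl_deriv_eq_0_iff:
  assumes "x \<noteq> a"
  shows "rl_deriv a \<alpha> p x = 0 \<longleftrightarrow> poly (frac_poly a p \<alpha>) (x - a) = 0"
  using assms by (simp add: rl_deriv_eq_frac_poly)

section \<open>Multiplicity and number of the nonzero roots\<close>

lemma double_zero_rl_deriv_nat:
  assumes "x \<noteq> a" "poly (frac_poly a p (real k)) (x - a) = 0"
    and "poly (pderiv (frac_poly a p (real k))) (x - a) = 0"
  shows "double_zero (rl_deriv a (real k) p) x"
proof -
  let ?P = "frac_poly a p (real k)"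
  \<comment> \<open>At an integer order the factor in front is 1 / (y - a)^k, which has no branch
    cut, so the quotient rule applies at every point other than a.\<close>
  have "((\<lambda>y. poly ?P (y - a) / (y - a) ^ k) has_field_derivative 0) (at x)"
    using assms by (auto intro!: derivative_eq_intros)
  moreover have "poly ?P (y - a) / (y - a) ^ k = rl_deriv a (real k) p y" if "y \<in> - {a}" for y
    using that by (simp add: rl_deriv_eq_frac_poly powr_minus powr_nat' field_simps)
  ultimately have "(rl_deriv a (real k) p has_field_derivative 0) (at x)"
    using assms(1) by (auto elim!: has_field_derivative_transform_within_open[where S = "- {a}"])
  then show ?thesis
    using assms by (simp add: double_zero_def rl_deriv_eq_0_iff)
qed

text \<open>Divide out the k-th power of the variable: every nonzero root is a root of the cofactor,
  whose degree is smaller by k.\<close>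

lemma card_nonzero_roots_le:
  fixes P :: "'a::idom poly"
  assumes "P \<noteq> 0" "\<And>j. j < k \<Longrightarrow> coeff P j = 0"
  shows "card {w. w \<noteq> 0 \<and> poly P w = 0} \<le> degree P - k"
proof -
  obtain Q where Q: "P = monom 1 k * Q"
    using assms(2) monom_1_dvd_iff'[of k P] by (auto elim: dvdE)
  have "Q \<noteq> 0" using Q assms(1) by auto
  have "{w. w \<noteq> 0 \<and> poly P w = 0} \<subseteq> {w. poly Q w = 0}"
    by (auto simp: Q poly_monom)
  then have "card {w. w \<noteq> 0 \<and> poly P w = 0} \<le> card {w. poly Q w = 0}"
    using poly_roots_finite[OF \<open>Q \<noteq> 0\<close>] by (rule card_mono[rotated])
  also have "\<dots> \<le> degree Q" using \<open>Q \<noteq> 0\<close> by (rule card_poly_roots_bound)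
  also have "degree Q = degree P - k"
    using \<open>Q \<noteq> 0\<close> by (simp add: Q degree_mult_eq degree_monom_eq)
  finally show ?thesis .
qed

section \<open>Limits of roots as the order varies\<close>

lemma poly_frac_poly_diff:
  "poly (frac_poly a p \<alpha>) u - poly (frac_poly a p \<alpha>) v =
     (u - v) * (\<Sum>j\<le>degree p. frac_coeff a p j \<alpha> * (\<Sum>i<j. v ^ (j - Suc i) * u ^ i))"
proof -
  have "c * u ^ j - c * v ^ j = (u - v) * (c * (\<Sum>i<j. v ^ (j - Suc i) * u ^ i))" for c :: complex and j
    unfolding right_diff_distrib[symmetric] power_diff_sumr2 by (rule mult.left_commute)
  then show ?thesis
    unfolding poly_frac_poly sum_subtractf[symmetric] by (simp only: sum_distrib_left[of "u - v"])
qed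

text \<open>The sum in \<open>poly_frac_poly_diff\<close> is a divided difference that stays
  meaningful when both points coincide. A general filter \<open>F\<close> lets t approach \<alpha>
  through nonintegral orders only.\<close>

lemma roots_collide:
  assumes u: "(u \<longlongrightarrow> w) F" and v: "(v \<longlongrightarrow> w) F"
    and F: "F \<le> nhds \<alpha>" "F \<noteq> bot"
    and ev: "\<forall>\<^sub>F t in F. u t \<noteq> v t \<and> poly (frac_poly a p t) (u t) = 0 \<and> poly (frac_poly a p t) (v t) = 0"
  shows "poly (pderiv (frac_poly a p \<alpha>)) w = 0"
proof -
  let ?G = "\<lambda>t u v. \<Sum>j\<le>degree p. frac_coeff a p j t * (\<Sum>i<j. v ^ (j - Suc i) * u ^ i)"
  have "(frac_coeff a p j \<longlongrightarrow> frac_coeff a p j \<alpha>) F" for j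
    using continuous_frac_coeff[of \<alpha> a p j] F(1)
    by (meson continuous_at tendsto_at_iff_tendsto_nhds tendsto_mono)
  then have "((\<lambda>t. ?G t (u t) (v t)) \<longlongrightarrow> ?G \<alpha> w w) F"
    by (intro tendsto_intros u v)
  moreover have "\<forall>\<^sub>F t in F. ?G t (u t) (v t) = 0"
    using ev
  proof eventually_elim
    case (elim t)
    then show ?case using poly_frac_poly_diff[of a p t "u t" "v t"] by simp
  qed
  then have "((\<lambda>t. ?G t (u t) (v t)) \<longlongrightarrow> 0) F" by (rule tendsto_eventually)
  ultimately have "?G \<alpha> w w = 0" by (rule tendsto_unique[OF F(2)])
  \<comment> \<open>On the diagonal the divided difference becomes the derivative.\<close>
  moreover have "(\<Sum>i<j. w ^ (j - Suc i) * w ^ i) = of_nat j * w ^ (j - 1)" for j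
  proof -
    have "(\<Sum>i<j. w ^ (j - Suc i) * w ^ i) = (\<Sum>i<j. w ^ (j - 1))"
      by (intro sum.cong) (auto simp flip: power_add)
    then show ?thesis by simp
  qed
  ultimately show ?thesis by (simp add: poly_pderiv_frac_poly)
qed

text \<open>A Cauchy-type root bound: at order n all coefficients but the leading one vanish, so
  near n the leading term dominates outside any disc about 0. The alternative \<open>w t = 0\<close>
  covers paths sitting at the base point.\<close>

lemma frac_poly_roots_tendsto_0:
  assumes "p \<noteq> 0" and F: "F \<le> nhds (real (degree p))"
    and ev: "\<forall>\<^sub>F t in F. w t = 0 \<or> poly (frac_poly a p t) (w t) = 0"
  shows "(w \<longlongrightarrow> 0) F"
proof (rule tendstoI)
  fix e :: real
  assume "e > 0"
  let ?n = "degree p"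
  let ?L = "\<lambda>t. norm (frac_coeff a p ?n t)"
  \<comment> \<open>For |w| \<ge> e one has |w|^j \<le> |w|^n / e^(n-j), so a root of modulus at
    least e forces \<open>?L t\<close> \<le> \<open>?R t\<close>.\<close>
  let ?R = "\<lambda>t. \<Sum>j<?n. norm (frac_coeff a p j t) / e ^ (?n - j)"
  have lim: "(frac_coeff a p j \<longlongrightarrow> frac_coeff a p j (real ?n)) F" for j
    using continuous_frac_coeff[of "real ?n" a p j] F
    by (meson continuous_at tendsto_at_iff_tendsto_nhds tendsto_mono)
  have "((\<lambda>t. ?L t - ?R t) \<longlongrightarrow> ?L ?n - ?R ?n) F"
    using \<open>e > 0\<close> by (intro tendsto_intros lim) auto
  moreover have "?L ?n - ?R ?n > 0"
    using lead_frac_coeff_nonzero[OF assms(1), of ?n a] by (simp add: frac_coeff_eq_0)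
  ultimately have "\<forall>\<^sub>F t in F. ?L t - ?R t > 0"
    by (rule order_tendstoD(1))
  with ev show "\<forall>\<^sub>F t in F. dist (w t) 0 < e"
  proof eventually_elim
    case (elim t)
    show ?case
    proof (rule ccontr)
      assume "\<not> dist (w t) 0 < e"
      then have e: "e \<le> norm (w t)" by simp
      with \<open>e > 0\<close> elim have "w t \<noteq> 0" and 0: "poly (frac_poly a p t) (w t) = 0" by auto
      have "frac_coeff a p ?n t * w t ^ ?n = - (\<Sum>j<?n. frac_coeff a p j t * w t ^ j)"
        using 0 unfolding poly_frac_poly lessThan_Suc_atMost[symmetric]
        by (simp add: eq_neg_iff_add_eq_0 add.commute)
      then have "?L t * norm (w t) ^ ?n = norm (\<Sum>j<?n. frac_coeff a p j t * w t ^ j)"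
        by (metis norm_minus_cancel norm_mult norm_power)
      also have "\<dots> \<le> (\<Sum>j<?n. norm (frac_coeff a p j t) * norm (w t) ^ j)"
        by (rule order_trans[OF norm_sum]) (simp add: norm_mult norm_power)
      also have "\<dots> \<le> (\<Sum>j<?n. norm (frac_coeff a p j t) / e ^ (?n - j) * norm (w t) ^ ?n)"
      proof (rule sum_mono)
        fix j assume "j \<in> {..<?n}"
        then have "norm (w t) ^ ?n = norm (w t) ^ j * norm (w t) ^ (?n - j)"
          by (simp flip: power_add)
        moreover have "e ^ (?n - j) \<le> norm (w t) ^ (?n - j)"
          using e \<open>e > 0\<close> by (intro power_mono) auto
        ultimately have "norm (w t) ^ j * e ^ (?n - j) \<le> norm (w t) ^ ?n"
          by (simp add: mult_left_mono)
        then have "norm (w t) ^ j \<le> norm (w t) ^ ?n / e ^ (?n - j)"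
          using \<open>e > 0\<close> by (simp add: pos_le_divide_eq)
        from mult_left_mono[OF this norm_ge_zero]
        show "norm (frac_coeff a p j t) * norm (w t) ^ j
            \<le> norm (frac_coeff a p j t) / e ^ (?n - j) * norm (w t) ^ ?n"
          by simp
      qed
      also have "\<dots> = ?R t * norm (w t) ^ ?n" by (simp add: sum_distrib_right)
      finally have "?L t \<le> ?R t" using \<open>w t \<noteq> 0\<close> by simp
      with elim show False by simp
    qed
  qed
qed

section \<open>Counting the paths that reach the base point\<close>

theorem theorem4p1:
  fixes a :: complex and p :: "complex poly" and n :: nat
    and r :: "nat \<Rightarrow> complex" and z :: "nat \<Rightarrow> real \<Rightarrow> complex"
  assumes "p \<noteq> 0" and "degree p = n"
    and "\<forall>\<alpha>\<in>{0..<real n}. \<forall>w. \<not> double_zero (rl_deriv a \<alpha> p) w"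
    and "bij_betw r {1..n} {w. poly p w = 0}"
    and "zero_paths a p n r z"
  shows "\<exists>\<sigma>. \<sigma> permutes {1..n} \<and>
           (\<forall>j\<in>{1..n}. (z (\<sigma> j) \<longlongrightarrow> a) (at (real j) within {0..<real n}))"
proof -
  have cont: "\<And>j. j \<in> {1..n} \<Longrightarrow> continuous_on {0..<real n} (z j)"
    and root: "\<And>j \<alpha>. j \<in> {1..n} \<Longrightarrow> \<alpha> \<in> {0..<real n} \<Longrightarrow> z j \<alpha> \<noteq> a \<Longrightarrow>
      poly (frac_poly a p \<alpha>) (z j \<alpha> - a) = 0"
    and dist: "\<And>i j \<alpha>. \<alpha> \<in> {0..<real n} - \<int> \<Longrightarrow> i \<in> {1..n} \<Longrightarrow> j \<in> {1..n} \<Longrightarrow>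
      i \<noteq> j \<Longrightarrow> z i \<alpha> \<noteq> a \<Longrightarrow> z i \<alpha> \<noteq> z j \<alpha>"
    using assms(5) unfolding zero_paths_def by (auto simp: rl_deriv_eq_0_iff)
  \<comment> \<open>Eligibility is a limit and not a value, because n lies outside the domain [0, n)
    of the paths.\<close>
  define S where "S k = {i \<in> {1..n}. (z i \<longlongrightarrow> a) (at (real k) within {0..<real n})}" for k
  have "k \<le> card (S k)" if k: "k \<in> {1..n}" for k
  proof (cases "k = n")
    case True
    have "(z i \<longlongrightarrow> a) (at (real n) within {0..<real n})" if i: "i \<in> {1..n}" for i
    proof -
      have "((\<lambda>t. z i t - a) \<longlongrightarrow> 0) (at (real n) within {0..<real n})"
      proof (rule frac_poly_roots_tendsto_0[OF assms(1)])
        show "at (real n) within {0..<real n} \<le> nhds (real (degree p))"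
          by (simp add: assms(2) at_within_def)
        show "\<forall>\<^sub>F t in at (real n) within {0..<real n}.
            z i t - a = 0 \<or> poly (frac_poly a p t) (z i t - a) = 0"
          using root[OF i] by (auto simp: eventually_at_filter intro!: always_eventually)
      qed
      then show ?thesis by (rule LIM_zero_cancel)
    qed
    then have "S k = {1..n}" using True by (auto simp: S_def)
    then show ?thesis using True by simp
  next
    case False
    let ?P = "frac_poly a p (real k)"
    \<comment> \<open>Integral orders are removed since \<open>zero_paths\<close> separates
      different indices only at nonintegral ones.\<close>
    let ?F = "at (real k) within ({0..<real n} - \<int>)"
    have mem: "real k \<in> {0..<real n}" using k False by auto
    have lim: "(z i \<longlongrightarrow> z i (real k)) (at (real k) within {0..<real n})" if "i \<in> {1..n}" for i
      using cont[OF that] mem by (auto simp: continuous_on_def)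
    have limF: "(z i \<longlongrightarrow> z i (real k)) ?F" if "i \<in> {1..n}" for i
      using lim[OF that] by (rule tendsto_within_subset) auto
    have ntriv: "?F \<noteq> bot"
    proof -
      have "real k islimpt ({0..<real n} - \<int>)"
        unfolding islimpt_approachable
      proof (intro allI impI)
        fix e :: real
        assume "e > 0"
        \<comment> \<open>A shift 0 < d < 1 leaves the integers, and k + 1 \<le> n keeps k + d
          inside [0, n).\<close>
        define d where "d = min e 1 / 2"
        have d: "0 < d" "d < 1" "d < e" using \<open>e > 0\<close> by (auto simp: d_def)
        have "real k + d \<notin> \<int>"
        proof
          assume "real k + d \<in> \<int>"
          then have "real k + d - real k \<in> \<int>" by (intro Ints_diff) auto
          then obtain m where "d = of_int m" by (auto elim: Ints_cases)
          with d show False by simp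
        qed
        moreover have "real k + 1 \<le> real n" using k False by auto
        ultimately show "\<exists>x'\<in>{0..<real n} - \<int>. x' \<noteq> real k \<and> dist x' (real k) < e"
          using d by (intro bexI[of _ "real k + d"]) (auto simp: dist_real_def)
      qed
      then show ?thesis by (simp add: trivial_limit_within)
    qed
    let ?N = "{i \<in> {1..n}. z i (real k) \<noteq> a}"
    let ?R = "{w. w \<noteq> 0 \<and> poly ?P w = 0}"
    \<comment> \<open>A meeting of two paths away from a would produce a double zero of the k-th
      derivative.\<close>
    have "inj_on (\<lambda>i. z i (real k) - a) ?N"
    proof (rule inj_onI, rule ccontr)
      fix i j
      assume i: "i \<in> ?N" and j: "j \<in> ?N" and "i \<noteq> j"
        and eq: "z i (real k) - a = z j (real k) - a"
      have "poly (pderiv ?P) (z i (real k) - a) = 0"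
      proof (rule roots_collide[where u = "\<lambda>t. z i t - a" and v = "\<lambda>t. z j t - a" and F = ?F])
        show "((\<lambda>t. z i t - a) \<longlongrightarrow> z i (real k) - a) ?F"
          using i by (intro tendsto_intros limF) auto
        show "((\<lambda>t. z j t - a) \<longlongrightarrow> z i (real k) - a) ?F"
          unfolding eq using j by (intro tendsto_intros limF) auto
        show "?F \<le> nhds (real k)" by (simp add: at_within_def)
        show "?F \<noteq> bot" by (rule ntriv)
        have "\<forall>\<^sub>F t in ?F. t \<in> {0..<real n} - \<int>" by (auto simp: eventually_at_filter)
        \<comment> \<open>Near k both paths stay off a, so both give roots of
          \<open>frac_poly a p t\<close>, and these are distinct.\<close>
        moreover have "\<forall>\<^sub>F t in ?F. z i t \<noteq> a"
          using i by (intro tendsto_imp_eventually_ne[OF limF]) auto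
        moreover have "\<forall>\<^sub>F t in ?F. z j t \<noteq> a"
          using j by (intro tendsto_imp_eventually_ne[OF limF]) auto
        ultimately show "\<forall>\<^sub>F t in ?F. z i t - a \<noteq> z j t - a \<and>
            poly (frac_poly a p t) (z i t - a) = 0 \<and> poly (frac_poly a p t) (z j t - a) = 0"
        proof eventually_elim
          case (elim t)
          then show ?case using dist[of t i j] root[of i t] root[of j t] i j \<open>i \<noteq> j\<close> by auto
        qed
      qed
      then have "double_zero (rl_deriv a (real k) p) (z i (real k))"
        using i root[of i "real k"] mem by (intro double_zero_rl_deriv_nat) auto
      then show False using assms(3) mem by blast
    qed
    have "coeff ?P n \<noteq> 0"
      using lead_frac_coeff_nonzero[OF assms(1), of "real k" a] mem assms(2)
      by (simp add: coeff_frac_poly)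
    then have "?P \<noteq> 0" by auto
    have "card ?N \<le> card ?R"
    proof (rule card_inj_on_le)
      show "inj_on (\<lambda>i. z i (real k) - a) ?N" by fact
      show "(\<lambda>i. z i (real k) - a) ` ?N \<subseteq> ?R" using root mem by auto
      show "finite ?R" by (rule finite_subset[OF _ poly_roots_finite[OF \<open>?P \<noteq> 0\<close>]]) auto
    qed
    also have "\<dots> \<le> degree ?P - k"
      by (rule card_nonzero_roots_le[OF \<open>?P \<noteq> 0\<close>]) (simp add: coeff_frac_poly frac_coeff_eq_0)
    also have "degree ?P \<le> n"
      by (rule degree_le) (simp add: coeff_frac_poly assms(2))
    finally have "card ?N \<le> n - k" by simp
    \<comment> \<open>A path with value a at order k has limit a there by continuity. At most n - k
      paths lie in \<open>?N\<close>, so at least k remain.\<close>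
    moreover have "{1..n} - ?N \<subseteq> S k"
    proof
      fix i
      assume "i \<in> {1..n} - ?N"
      then show "i \<in> S k" using lim[of i] by (auto simp: S_def)
    qed
    then have "card ({1..n} - ?N) \<le> card (S k)"
      by (rule card_mono[rotated]) (simp add: S_def)
    moreover have "card ({1..n} - ?N) = n - card ?N"
      by (subst card_Diff_subset) auto
    ultimately show ?thesis using k by auto
  qed
  then have "\<exists>\<sigma>. \<sigma> permutes {1..n} \<and> (\<forall>k\<in>{1..n}. \<sigma> k \<in> S k)"
    by (intro greedy_permutation) (auto simp: S_def)
  then show ?thesis unfolding S_def by blast
qed

end
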